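(* For each integer $n\ge 1$, there is a graph $G^*$ on $5n$ vertices that is not partially DP-nice and satisfies $\alpha_2^{DP}(G^* )=3n<2|V(G^* )|/3=10n/3$.
   Context: All graphs are nonempty, finite and simple. For $m\in\mathbb{N}=\{1,2,\dots\}$ write $[m]=\{1,\dots,m\}$. For $S,U\subseteq V(H)$, $E_H(S,U)$ is the set of edges of $H$ with at least one endpoint in $S$ and at least one endpoint in $U$. A cover of a graph $G$ is a pair $\mathcal{H}=(L,H)$ where $H$ is a graph and $L:V(G)\to\mathcal{P}(V(H))$ satisfies: (1) the sets $L(u)$, $u\in V(G)$, partition $V(H)$; (2) $H[L(u)]$ is complete for every $u\in V(G)$; (3) for every $uv\in E(G)$, $E_H(L(u),L(v))$ is a (possibly empty) matching; (4) if $u\neq v$ and $uv\notin E(G)$, then $E_H(L(u),L(v))=\emptyset$. The cover is $m$-fold if $|L(u)|=m$ for all $u\in V(G)$. An $\mathcal{H}$-coloring of $G$ is an independent set of size $|V(G)|$ in $H$. The DP-chromatic number $\chi_{DP}(G)$ is the smallest $m$ such that $G$ has an $\mathcal{H}$-coloring for every $m$-fold cover $\mathcal{H}$ of $G$. For $t\in\mathbb{N}$, the partial DP $t$-chromatic number $\alpha_t^{DP}(G)$ is the minimum of $\alpha(H)$ (the independence number of $H$) over all $t$-fold covers $\mathcal{H}=(L,H)$ of $G$. A graph $G$ is partially DP-nice if $\alpha_t^{DP}(G)\ge t|V(G)|/\chi_{DP}(G)$ for all $t\in[\chi_{DP}(G)]$. *)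

theory Defs
  imports Complex_Main "HOL-Library.Disjoint_Sets" "HOL-Library.Ramsey"
begin

type_synonym 'a graph = "'a set \<times> 'a set set"

abbreviation verts :: "'a graph \<Rightarrow> 'a set" where "verts \<equiv> fst"
abbreviation edges :: "'a graph \<Rightarrow> 'a set set" where "edges \<equiv> snd"

definition simple_graph :: "'a graph \<Rightarrow> bool" where
  "simple_graph G \<longleftrightarrow> finite (verts G) \<and> verts G \<noteq> {} \<and> edges G \<subseteq> [verts G]\<^bsup>2\<^esup>"

definition edges_between :: "'a graph \<Rightarrow> 'a set \<Rightarrow> 'a set \<Rightarrow> 'a set set" where
  "edges_between H S U = {e \<in> edges H. e \<inter> S \<noteq> {} \<and> e \<inter> U \<noteq> {}}"

definition independent_set :: "'a graph \<Rightarrow> 'a set \<Rightarrow> bool" where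
  "independent_set H I \<longleftrightarrow> I \<subseteq> verts H \<and> indep I (edges H)"

definition independence_number :: "'a graph \<Rightarrow> nat" where
  "independence_number H = Max {card I |I. independent_set H I}"

text \<open>A set of edges is a matching iff its elements are pairwise disjoint. The values of \<open>L\<close>
  outside the vertices of \<open>G\<close> are irrelevant.\<close>

definition dp_cover :: "'a graph \<Rightarrow> ('a \<Rightarrow> 'b set) \<Rightarrow> 'b graph \<Rightarrow> bool" where
  "dp_cover G L H \<longleftrightarrow>
     simple_graph H \<and>
     disjoint_family_on L (verts G) \<and> (\<Union>u\<in>verts G. L u) = verts H \<and>
     (\<forall>u\<in>verts G. clique (L u) (edges H)) \<and>
     (\<forall>u v. {u, v} \<in> edges G \<longrightarrow> disjoint (edges_between H (L u) (L v))) \<and>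
     (\<forall>u\<in>verts G. \<forall>v\<in>verts G. u \<noteq> v \<and> {u, v} \<notin> edges G \<longrightarrow>
        edges_between H (L u) (L v) = {})"

definition fold_cover :: "nat \<Rightarrow> 'a graph \<Rightarrow> ('a \<Rightarrow> 'b set) \<Rightarrow> 'b graph \<Rightarrow> bool" where
  "fold_cover m G L H \<longleftrightarrow> dp_cover G L H \<and> (\<forall>u\<in>verts G. card (L u) = m)"

definition dp_coloring :: "'a graph \<Rightarrow> 'b graph \<Rightarrow> 'b set \<Rightarrow> bool" where
  "dp_coloring G H I \<longleftrightarrow> independent_set H I \<and> card I = card (verts G)"

text \<open>Cover graphs are finite, so it is enough to let them range over graphs on natural numbers;
  lemma \<open>fold_cover_relabel_nat\<close> below shows that nothing is lost. The bound \<open>1 \<le> m\<close> is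
  essential: a nonempty graph has no \<open>0\<close>-fold cover.\<close>

definition dp_chromatic_number :: "'a graph \<Rightarrow> nat" where
  "dp_chromatic_number G =
     (LEAST m. 1 \<le> m \<and>
        (\<forall>L (H :: nat graph). fold_cover m G L H \<longrightarrow> (\<exists>I. dp_coloring G H I)))"

definition partial_dp_chromatic_number :: "nat \<Rightarrow> 'a graph \<Rightarrow> nat" where
  "partial_dp_chromatic_number t G =
     (LEAST k. \<exists>L (H :: nat graph). fold_cover t G L H \<and> independence_number H = k)"

definition partially_dp_nice :: "'a graph \<Rightarrow> bool" where
  "partially_dp_nice G \<longleftrightarrow>
     (\<forall>t \<in> {1..dp_chromatic_number G}.
        real (partial_dp_chromatic_number t G)
          \<ge> real t * real (card (verts G)) / real (dp_chromatic_number G))"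

lemma fold_cover_relabel_nat:
  fixes H :: "'b graph"
  assumes "fold_cover m G L H"
  shows "\<exists>L' (H' :: nat graph). fold_cover m G L' H' \<and>
           independence_number H' = independence_number H \<and>
           ((\<exists>I. dp_coloring G H' I) \<longleftrightarrow> (\<exists>I. dp_coloring G H I))"
proof -
  have cov: "dp_cover G L H" and crd: "\<And>u. u \<in> verts G \<Longrightarrow> card (L u) = m"
    using assms by (auto simp: fold_cover_def)
  have H: "finite (verts H)" "verts H \<noteq> {}" "edges H \<subseteq> [verts H]\<^bsup>2\<^esup>"
    using cov by (auto simp: dp_cover_def simple_graph_def)
  obtain f :: "'b \<Rightarrow> nat" where f: "inj_on f (verts H)"
    using finite_imp_inj_to_nat_seg[OF H(1)] by blast
  have sub: "L u \<subseteq> verts H" if "u \<in> verts G" for u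
    using cov that by (auto simp: dp_cover_def)
  have esub: "e \<subseteq> verts H" if "e \<in> edges H" for e
    using H(3) that by (auto simp: nsets_def)
  define H' where "H' = (f ` verts H, image f ` edges H)"
  define L' where "L' = (\<lambda>u. if u \<in> verts G then f ` L u else {})"
  have vH': "verts H' = f ` verts H" and eH': "edges H' = image f ` edges H"
    by (auto simp: H'_def)
  have inj_im: "inj_on (image f) (Pow (verts H))"
    using f by (simp add: inj_on_image_Pow)
  have edge_iff: "f ` e \<in> edges H' \<longleftrightarrow> e \<in> edges H" if "e \<subseteq> verts H" for e
    unfolding eH' using inj_im that esub by (metis (no_types, lifting) PowI imageE imageI inj_onD)
  have inter: "f ` A \<inter> f ` B = {} \<longleftrightarrow> A \<inter> B = {}" if "A \<subseteq> verts H" "B \<subseteq> verts H" for A B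
    using inj_on_image_Int[OF f that] by (metis image_is_empty)
  have pair_iff: "{f x, f y} \<in> edges H' \<longleftrightarrow> {x, y} \<in> edges H"
    if "x \<in> verts H" "y \<in> verts H" for x y
    using edge_iff[of "{x, y}"] that by simp
  have fneq: "f x = f y \<longleftrightarrow> x = y" if "x \<in> verts H" "y \<in> verts H" for x y
    using f that by (auto dest: inj_onD)
  have indep_iff: "independent_set H' (f ` I) \<longleftrightarrow> independent_set H I" if "I \<subseteq> verts H" for I
  proof -
    have "(\<forall>v\<in>I. \<forall>w\<in>I. f v \<noteq> f w \<longrightarrow> {f v, f w} \<notin> edges H')
      \<longleftrightarrow> (\<forall>v\<in>I. \<forall>w\<in>I. v \<noteq> w \<longrightarrow> {v, w} \<notin> edges H)"
      using that pair_iff fneq by (meson subsetD)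
    then show ?thesis
      using that by (auto simp: independent_set_def indep_def vH')
  qed
  have cardf: "card (f ` I) = card I" if "I \<subseteq> verts H" for I
    using f that by (meson card_image inj_on_subset)
  have ind_transfer: "{card I |I. independent_set H' I} = {card I |I. independent_set H I}"
  proof (intro equalityI subsetI)
    fix k assume "k \<in> {card I |I. independent_set H' I}"
    then obtain I where I: "independent_set H' I" "k = card I" by blast
    then have "I \<subseteq> f ` verts H" by (simp add: independent_set_def vH')
    then obtain J where "J \<subseteq> verts H" "I = f ` J" by (meson subset_imageE)
    then show "k \<in> {card I |I. independent_set H I}"
      using I indep_iff cardf by blast
  next
    fix k assume "k \<in> {card I |I. independent_set H I}"
    then obtain I where I: "independent_set H I" "k = card I" by blast
    then have "I \<subseteq> verts H" by (simp add: independent_set_def)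
    then show "k \<in> {card I |I. independent_set H' I}"
      using I indep_iff cardf by (metis (mono_tags, lifting) mem_Collect_eq)
  qed
  have between: "edges_between H' (f ` A) (f ` B) = image f ` edges_between H A B"
    if "A \<subseteq> verts H" "B \<subseteq> verts H" for A B
  proof -
    have "f ` e \<inter> f ` A \<noteq> {} \<and> f ` e \<inter> f ` B \<noteq> {} \<longleftrightarrow> e \<inter> A \<noteq> {} \<and> e \<inter> B \<noteq> {}"
      if "e \<in> edges H" for e
      using inter[OF esub[OF that]] \<open>A \<subseteq> verts H\<close> \<open>B \<subseteq> verts H\<close> by simp
    then have "{e \<in> edges H. f ` e \<inter> f ` A \<noteq> {} \<and> f ` e \<inter> f ` B \<noteq> {}}
        = {e \<in> edges H. e \<inter> A \<noteq> {} \<and> e \<inter> B \<noteq> {}}"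
      by (metis (no_types, lifting))
    moreover have "{d \<in> image f ` edges H. P d} = image f ` {e \<in> edges H. P (f ` e)}" for P
      by blast
    ultimately show ?thesis by (simp add: edges_between_def eH')
  qed
  have "simple_graph H'"
  proof -
    have "edges H' \<subseteq> [verts H']\<^bsup>2\<^esup>"
    proof
      fix e assume "e \<in> edges H'"
      then obtain d where d: "d \<in> edges H" "e = f ` d" by (auto simp: eH')
      then have "d \<subseteq> verts H" "finite d" "card d = 2"
        using H(3) by (auto simp: nsets_def)
      then show "e \<in> [verts H']\<^bsup>2\<^esup>"
        using d(2) cardf by (auto simp: nsets_def vH')
    qed
    then show ?thesis using H by (simp add: simple_graph_def vH')
  qed
  moreover have "disjoint_family_on L' (verts G)"
    using cov sub inter by (simp add: dp_cover_def disjoint_family_on_def L'_def)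
  moreover have "(\<Union>u\<in>verts G. L' u) = verts H'"
  proof -
    have "verts H = (\<Union>u\<in>verts G. L u)" using cov by (simp add: dp_cover_def)
    then show ?thesis by (simp add: L'_def vH' image_UN)
  qed
  moreover have "\<forall>u\<in>verts G. clique (L' u) (edges H')"
  proof
    fix u assume u: "u \<in> verts G"
    then have "clique (L u) (edges H)" using cov by (simp add: dp_cover_def)
    then show "clique (L' u) (edges H')"
      using u sub[OF u] pair_iff by (auto simp: clique_def L'_def subset_iff)
  qed
  moreover have "\<forall>u v. {u, v} \<in> edges G \<longrightarrow> disjoint (edges_between H' (L' u) (L' v))"
  proof (intro allI impI)
    fix u v assume uv: "{u, v} \<in> edges G"
    show "disjoint (edges_between H' (L' u) (L' v))"
    proof (cases "u \<in> verts G \<and> v \<in> verts G")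
      case True
      then have eq: "edges_between H' (L' u) (L' v) = image f ` edges_between H (L u) (L v)"
        using between sub by (simp add: L'_def)
      have dis: "disjoint (edges_between H (L u) (L v))"
        using cov uv by (simp add: dp_cover_def)
      show ?thesis unfolding eq
      proof (rule disjointI)
        fix a b assume "a \<in> image f ` edges_between H (L u) (L v)"
          "b \<in> image f ` edges_between H (L u) (L v)" "a \<noteq> b"
        then obtain c d where cd: "c \<in> edges_between H (L u) (L v)"
          "d \<in> edges_between H (L u) (L v)" "a = f ` c" "b = f ` d" "c \<noteq> d"
          by blast
        then have "c \<inter> d = {}" using disjointD[OF dis] by blast
        moreover have "c \<subseteq> verts H" "d \<subseteq> verts H"
          using cd esub by (auto simp: edges_between_def)
        ultimately show "a \<inter> b = {}" using inter cd by simp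
      qed
    next
      case False
      then have "edges_between H' (L' u) (L' v) = {}"
        by (auto simp: edges_between_def L'_def)
      then show ?thesis by simp
    qed
  qed
  moreover have "\<forall>u\<in>verts G. \<forall>v\<in>verts G. u \<noteq> v \<and> {u, v} \<notin> edges G \<longrightarrow>
        edges_between H' (L' u) (L' v) = {}"
    using cov between sub by (simp add: dp_cover_def L'_def)
  ultimately have "dp_cover G L' H'" by (simp add: dp_cover_def)
  moreover have "\<forall>u\<in>verts G. card (L' u) = m"
    using crd sub cardf by (simp add: L'_def)
  ultimately have "fold_cover m G L' H'" by (simp add: fold_cover_def)
  moreover have "independence_number H' = independence_number H"
    by (simp add: independence_number_def ind_transfer)
  moreover have "(\<exists>I. dp_coloring G H' I) \<longleftrightarrow> (\<exists>I. dp_coloring G H I)"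
  proof -
    have "(\<exists>I. dp_coloring G H' I)
        \<longleftrightarrow> card (verts G) \<in> {card I |I. independent_set H' I}"
      unfolding dp_coloring_def mem_Collect_eq by metis
    moreover have "(\<exists>I. dp_coloring G H I)
        \<longleftrightarrow> card (verts G) \<in> {card I |I. independent_set H I}"
      unfolding dp_coloring_def mem_Collect_eq by metis
    ultimately show ?thesis using ind_transfer by simp
  qed
  ultimately show ?thesis by blast
qed

end

theory Submission
  imports Defs
begin

text \<open>The graph is \<open>n\<close> disjoint copies of \<open>K\<^sub>4\<close> with one edge subdivided. It is 2-degenerate, so
  greedy colouring handles every 3-fold cover, and each copy has an induced path on three vertices,
  on which greedy colouring handles every 2-fold cover. A 2-fold cover with perfect matchings is a
  signed graph, and an independent set in it is the same as a vertex set inducing no unbalanced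
  cycle, together with a switching. Sign the subdivided \<open>K\<^sub>4\<close> so that the cycles coming from the four
  triangles of \<open>K\<^sub>4\<close> are all unbalanced: no single vertex meets all four of these, so two of
  the five vertices are missed by every independent set.\<close>

section \<open>Bounds on the independence number\<close>

lemma card_le_independence_number:
  assumes "finite (verts H)" "independent_set H I"
  shows "card I \<le> independence_number H"
proof -
  have "{card I |I. independent_set H I} \<subseteq> card ` Pow (verts H)"
    by (auto simp: independent_set_def)
  then have "finite {card I |I. independent_set H I}"
    using assms(1) by (meson finite_Pow_iff finite_imageI finite_subset)
  then show ?thesis
    unfolding independence_number_def using assms(2) by (intro Max_ge) auto
qed

lemma independence_number_le:
  assumes "finite (verts H)" "\<And>I. independent_set H I \<Longrightarrow> card I \<le> b"
  shows "independence_number H \<le> b"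
proof -
  have "{card I |I. independent_set H I} \<subseteq> card ` Pow (verts H)"
    by (auto simp: independent_set_def)
  then have "finite {card I |I. independent_set H I}"
    using assms(1) by (meson finite_Pow_iff finite_imageI finite_subset)
  \<comment> \<open>The empty set is what makes the set of cardinalities nonempty, so that its
    \<open>Max\<close> can be bounded elementwise.\<close>
  moreover have "independent_set H {}"
    by (simp add: independent_set_def indep_def)
  ultimately show ?thesis
    unfolding independence_number_def using assms(2) by (subst Max_le_iff) auto
qed

section \<open>Greedy selection from a cover\<close>

text \<open>Each earlier neighbour of \<open>v\<close> blocks at most one element of
  \<open>L v\<close>, because the edges between two fibres form a matching. With fewer than
  \<open>m\<close> earlier neighbours, one of the \<open>m\<close> elements stays free.\<close>

lemma greedy_selection:
  fixes G :: "'a::linorder graph"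
  assumes cover: "fold_cover m G L H"
    and "finite S" "S \<subseteq> verts G"
    and "\<And>v. v \<in> S \<Longrightarrow> card {u \<in> S. u < v \<and> {u, v} \<in> edges G} < m"
  shows "\<exists>f. (\<forall>v\<in>S. f v \<in> L v) \<and> (\<forall>u\<in>S. \<forall>v\<in>S. u \<noteq> v \<longrightarrow> {f u, f v} \<notin> edges H)"
  using assms(2-4)
\<comment> \<open>Vertices enter in increasing order, so every neighbour of the new vertex
  \<open>b\<close> in \<open>S\<close> is an earlier one.\<close>
proof (induction S rule: finite_linorder_max_induct)
  case empty
  show ?case by simp
next
  case (insert b S)
  have "card {u \<in> S. u < v \<and> {u, v} \<in> edges G} < m" if "v \<in> S" for v
  proof -
    have "{u \<in> S. u < v \<and> {u, v} \<in> edges G} \<subseteq> {u \<in> insert b S. u < v \<and> {u, v} \<in> edges G}"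
      by auto
    then have "card {u \<in> S. u < v \<and> {u, v} \<in> edges G}
      \<le> card {u \<in> insert b S. u < v \<and> {u, v} \<in> edges G}"
      by (rule card_mono[rotated]) (use insert.hyps in auto)
    then show ?thesis using insert.prems(2)[of v] that by simp
  qed
  then obtain f where f: "\<forall>v\<in>S. f v \<in> L v"
      "\<forall>u\<in>S. \<forall>v\<in>S. u \<noteq> v \<longrightarrow> {f u, f v} \<notin> edges H"
    using insert.IH insert.prems(1) by auto
  define N where "N = {u \<in> S. {u, b} \<in> edges G}"
  \<comment> \<open>The elements of \<open>L b\<close> that are blocked by the choice already made
    at \<open>u\<close>.\<close>
  define B where "B u = {x \<in> L b. {f u, x} \<in> edges H}" for u
  have bV: "b \<in> verts G" and SV: "S \<subseteq> verts G" and bS: "b \<notin> S"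
    using insert.hyps insert.prems(1) by blast+
  have "card (B u) \<le> 1" if "u \<in> N" for u
  proof -
    have "x = y" if "x \<in> B u" "y \<in> B u" for x y
    proof -
      have u: "u \<in> S" "{u, b} \<in> edges G" using \<open>u \<in> N\<close> by (auto simp: N_def)
      have "disjoint (edges_between H (L u) (L b))"
        using cover u by (auto simp: fold_cover_def dp_cover_def)
      moreover have "{f u, x} \<in> edges_between H (L u) (L b)"
        "{f u, y} \<in> edges_between H (L u) (L b)"
        using that f(1) u by (auto simp: B_def edges_between_def)
      \<comment> \<open>Two edges of a matching that share the endpoint \<open>f u\<close>
        coincide.\<close>
      ultimately have "{f u, x} = {f u, y}"
        using disjointD by fastforce
      then show "x = y" by (metis doubleton_eq_iff)
    qed
    \<comment> \<open>The infinite case is covered by the convention that \<open>card\<close> is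
      then 0.\<close>
    then show ?thesis
      by (metis One_nat_def card_le_Suc0_iff_eq card.infinite zero_le)
  qed
  then have "card (\<Union>u\<in>N. B u) \<le> card N"
    using card_UN_le[of N B] sum_bounded_above[of N "\<lambda>u. card (B u)" 1] insert.hyps
    by (simp add: N_def)
  also have "card N < m"
  proof -
    have "N = {u \<in> insert b S. u < b \<and> {u, b} \<in> edges G}"
      using insert.hyps by (auto simp: N_def)
    then show ?thesis using insert.prems(2)[of b] by simp
  qed
  also have "m = card (L b)" using cover bV by (simp add: fold_cover_def)
  finally have less: "card (\<Union>u\<in>N. B u) < card (L b)" .
  have "\<not> L b \<subseteq> (\<Union>u\<in>N. B u)"
  proof
    assume "L b \<subseteq> (\<Union>u\<in>N. B u)"
    then have "L b = (\<Union>u\<in>N. B u)" by (auto simp: B_def)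
    with less show False by simp
  qed
  then obtain x where x: "x \<in> L b" "x \<notin> (\<Union>u\<in>N. B u)" by blast
  \<comment> \<open>At neighbours of \<open>b\<close> the choice of \<open>x\<close> avoids the
    blocked elements; at other vertices the cover has no edges between the fibres.\<close>
  have new: "{f u, x} \<notin> edges H" if "u \<in> S" for u
  proof (cases "u \<in> N")
    case True
    then show ?thesis using x by (auto simp: B_def)
  next
    case False
    then have "u \<in> verts G" "u \<noteq> b" "{u, b} \<notin> edges G"
      using SV bS that by (auto simp: N_def)
    then have "edges_between H (L u) (L b) = {}"
      using cover bV by (simp add: fold_cover_def dp_cover_def)
    then show ?thesis using f(1) that x(1) by (auto simp: edges_between_def)
  qed
  let ?g = "f(b := x)"
  have "\<forall>v\<in>insert b S. ?g v \<in> L v" using f x bS by auto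
  moreover have "\<forall>u\<in>insert b S. \<forall>v\<in>insert b S. u \<noteq> v \<longrightarrow> {?g u, ?g v} \<notin> edges H"
    using f(2) new by (auto simp: insert_commute)
  ultimately show ?case by blast
qed

text \<open>Fibres are disjoint, so the greedy selection is injective and its image has as many
  elements as \<open>S\<close>. Taking \<open>S\<close> to be all vertices yields a colouring, a
  smaller \<open>S\<close> a lower bound for the independence number.\<close>

lemma greedy_independent_set:
  fixes G :: "'a::linorder graph"
  assumes cover: "fold_cover m G L H"
    and S: "finite S" "S \<subseteq> verts G"
    and "\<And>v. v \<in> S \<Longrightarrow> card {u \<in> S. u < v \<and> {u, v} \<in> edges G} < m"
  shows "\<exists>I. independent_set H I \<and> card I = card S"
proof -
  obtain f where f: "\<forall>v\<in>S. f v \<in> L v"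
      "\<forall>u\<in>S. \<forall>v\<in>S. u \<noteq> v \<longrightarrow> {f u, f v} \<notin> edges H"
    using greedy_selection[OF assms] by blast
  have "inj_on f S"
  proof (rule inj_onI, rule ccontr)
    fix u v assume "u \<in> S" "v \<in> S" "f u = f v" "u \<noteq> v"
    then have "L u \<inter> L v = {}" "f u \<in> L u" "f u \<in> L v"
      using cover S f(1)
      unfolding fold_cover_def dp_cover_def disjoint_family_on_def by (metis subsetD)+
    then show False by blast
  qed
  then have "card (f ` S) = card S" by (rule card_image)
  moreover have "f ` S \<subseteq> verts H"
    using cover S f(1) unfolding fold_cover_def dp_cover_def by blast
  then have "independent_set H (f ` S)"
    using f(2) by (auto simp: independent_set_def indep_def)
  ultimately show ?thesis by blast
qed

section \<open>Two-fold covers from signed graphs\<close>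

text \<open>The set \<open>F\<close> carries the signature: the matching over an edge in
  \<open>F\<close> is crossed, over any other edge it is straight. An independent set therefore has
  equal labels across edges in \<open>F\<close> and different labels across the others.\<close>

definition double_cover :: "'a graph \<Rightarrow> 'a set set \<Rightarrow> ('a \<times> bool) graph" where
  "double_cover G F = (verts G \<times> UNIV,
     {{(u, i), (v, j)} |u v i j. u \<in> verts G \<and> v \<in> verts G \<and>
        (u = v \<and> i \<noteq> j \<or> {u, v} \<in> edges G \<and> (i = j \<longleftrightarrow> {u, v} \<notin> F))})"

lemma simple_graph_edgeD:
  assumes "simple_graph G" "{u, v} \<in> edges G"
  shows "u \<noteq> v" "u \<in> verts G" "v \<in> verts G"
  using assms by (auto simp: simple_graph_def nsets_def)

lemma double_cover_edge_iff:
  "{(u, i), (v, j)} \<in> edges (double_cover G F) \<longleftrightarrow> u \<in> verts G \<and> v \<in> verts G \<and>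
     (u = v \<and> i \<noteq> j \<or> {u, v} \<in> edges G \<and> (i = j \<longleftrightarrow> {u, v} \<notin> F))"
  by (auto simp: double_cover_def doubleton_eq_iff insert_commute)

text \<open>Straight and crossed matchings are both perfect matchings of two fibres of size 2:
  either endpoint determines the other.\<close>

lemma fold_cover_double_cover:
  assumes G: "simple_graph G"
  shows "fold_cover 2 G (\<lambda>v. {v} \<times> UNIV) (double_cover G F)"
proof -
  let ?H = "double_cover G F" and ?L = "\<lambda>v. {v} \<times> (UNIV :: bool set)"
  \<comment> \<open>Normal form with the endpoint over \<open>u\<close> written first; since the
    sign of the edge is fixed, \<open>i\<close> and \<open>j\<close> determine each other, so
    distinct edges differ at both ends.\<close>
  have edge: "\<exists>i j. e = {(u, i), (v, j)} \<and> {u, v} \<in> edges G \<and> (i = j \<longleftrightarrow> {u, v} \<notin> F)"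
    if e: "e \<in> edges_between ?H (?L u) (?L v)" and "u \<noteq> v" for e u v
  proof -
    obtain a b i j where ab: "e = {(a, i), (b, j)}"
      "a = b \<and> i \<noteq> j \<or> {a, b} \<in> edges G \<and> (i = j \<longleftrightarrow> {a, b} \<notin> F)"
      using e by (auto simp: edges_between_def double_cover_def)
    have "a = u \<and> b = v \<or> a = v \<and> b = u"
      using e \<open>u \<noteq> v\<close> ab(1) by (auto simp: edges_between_def)
    then show ?thesis
    proof
      assume "a = u \<and> b = v"
      then show ?thesis using ab \<open>u \<noteq> v\<close> by blast
    next
      assume "a = v \<and> b = u"
      then have "e = {(u, j), (v, i)} \<and> {u, v} \<in> edges G \<and> (j = i \<longleftrightarrow> {u, v} \<notin> F)"
        using ab \<open>u \<noteq> v\<close> by (auto simp: insert_commute)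
      then show ?thesis by blast
    qed
  qed
  have "e \<in> [verts ?H]\<^bsup>2\<^esup>" if "e \<in> edges ?H" for e
  proof -
    obtain u v i j where e: "e = {(u, i), (v, j)}" "u \<in> verts G" "v \<in> verts G"
      "u = v \<and> i \<noteq> j \<or> {u, v} \<in> edges G"
      using \<open>e \<in> edges ?H\<close> by (auto simp: double_cover_def)
    then have "(u, i) \<noteq> (v, j)" using simple_graph_edgeD(1)[OF G] by blast
    then show ?thesis using e(1-3) by (simp add: nsets_def double_cover_def)
  qed
  then have "edges ?H \<subseteq> [verts ?H]\<^bsup>2\<^esup>" by (rule subsetI)
  moreover have "finite (verts ?H)" "verts ?H \<noteq> {}"
    using G by (auto simp: simple_graph_def double_cover_def)
  ultimately have "simple_graph ?H"
    by (simp add: simple_graph_def)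
  moreover have "clique (?L u) (edges ?H)" if "u \<in> verts G" for u
    using that by (auto simp: clique_def double_cover_edge_iff)
  moreover have "disjoint (edges_between ?H (?L u) (?L v))" if "{u, v} \<in> edges G" for u v
  proof (rule disjointI)
    fix d e
    assume d: "d \<in> edges_between ?H (?L u) (?L v)" and e: "e \<in> edges_between ?H (?L u) (?L v)"
      and "d \<noteq> e"
    have "u \<noteq> v" using simple_graph_edgeD[OF G that] by blast
    then show "d \<inter> e = {}"
      using edge[OF d] edge[OF e] \<open>d \<noteq> e\<close> by auto
  qed
  moreover have "edges_between ?H (?L u) (?L v) = {}" if "u \<noteq> v" "{u, v} \<notin> edges G" for u v
    using edge that by blast
  moreover have "disjoint_family_on ?L (verts G)"
    by (auto simp: disjoint_family_on_def)
  moreover have "(\<Union>u\<in>verts G. ?L u) = verts ?H"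
    by (auto simp: double_cover_def)
  ultimately show ?thesis
    by (auto simp: fold_cover_def dp_cover_def card_cartesian_product)
qed

text \<open>Each fibre is an edge, so at most one of its elements is chosen. Hence
  \<open>card I\<close> counts the vertices of \<open>G\<close> that are reached.\<close>

lemma double_cover_inj_on_fst:
  assumes "independent_set (double_cover G F) I"
  shows "inj_on fst I"
proof (rule inj_onI, rule ccontr)
  fix x y assume xy: "x \<in> I" "y \<in> I" "fst x = fst y" "x \<noteq> y"
  then have "fst x \<in> verts G"
    using assms by (auto simp: independent_set_def double_cover_def)
  then have "{x, y} \<in> edges (double_cover G F)"
    using xy by (cases x, cases y) (auto simp: double_cover_edge_iff)
  then show False
    using assms xy by (auto simp: independent_set_def indep_def)
qed

text \<open>The labels chosen by \<open>I\<close> are the switching \<open>c\<close>. Around a cycle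
  inside the projection of \<open>I\<close> the label must change an even number of times, which
  rules out cycles with an odd number of edges outside \<open>F\<close>.\<close>

lemma double_cover_switching:
  assumes I: "independent_set (double_cover G F) I" and G: "simple_graph G"
  shows "\<exists>c :: 'a \<Rightarrow> bool. \<forall>u\<in>fst ` I. \<forall>v\<in>fst ` I.
           {u, v} \<in> edges G \<longrightarrow> (c u = c v \<longleftrightarrow> {u, v} \<in> F)"
proof -
  define c where "c u = (SOME i. (u, i) \<in> I)" for u
  have c: "(w, c w) \<in> I" if "w \<in> fst ` I" for w
    using that unfolding c_def by (metis imageE prod.collapse someI)
  have "c u = c v \<longleftrightarrow> {u, v} \<in> F" if uv: "u \<in> fst ` I" "v \<in> fst ` I" "{u, v} \<in> edges G" for u v
  proof -
    have "u \<noteq> v" "u \<in> verts G" "v \<in> verts G"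
      using simple_graph_edgeD[OF G uv(3)] by auto
    moreover from \<open>u \<noteq> v\<close> have "{(u, c u), (v, c v)} \<notin> edges (double_cover G F)"
      using I c[OF uv(1)] c[OF uv(2)] by (auto simp: independent_set_def indep_def)
    ultimately show ?thesis using uv(3) by (auto simp: double_cover_edge_iff)
  qed
  then show ?thesis by blast
qed

text \<open>Between two singleton fibres there is at most one edge, so \<open>G\<close> covers
  itself. This cover serves to exclude the value 1 for the DP-chromatic number.\<close>

lemma fold_cover_trivial:
  assumes G: "simple_graph G"
  shows "fold_cover 1 G (\<lambda>v. {v}) G"
proof -
  have edge: "e = {u, v}" if "e \<in> edges_between G {u} {v}" "u \<noteq> v" for e u v
  proof -
    have "card e = 2" "finite e" "{u, v} \<subseteq> e"
      using that G by (auto simp: edges_between_def simple_graph_def nsets_def)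
    then show ?thesis using that(2) card_subset_eq[of e "{u, v}"] by simp
  qed
  have "disjoint (edges_between G {u} {v})" if "{u, v} \<in> edges G" for u v
    using edge simple_graph_edgeD(1)[OF G that] by (metis disjointI)
  moreover have "edges_between G {u} {v} = {}" if "u \<noteq> v" "{u, v} \<notin> edges G" for u v
    using edge[of _ u v] that by (fastforce simp: edges_between_def)
  ultimately show ?thesis
    using G by (auto simp: fold_cover_def dp_cover_def disjoint_family_on_def clique_def)
qed

text \<open>Vertex 4 subdivides the edge between 2 and 3. Arcs point upwards, and no vertex has more than
  two incoming arcs.\<close>

definition subdivided_K4_arcs :: "(nat \<times> nat) set" where
  "subdivided_K4_arcs = {(0, 1), (0, 2), (0, 3), (1, 2), (1, 3), (2, 4), (3, 4)}"

text \<open>Vertex \<open>r\<close> of copy \<open>k\<close> is the number \<open>5 * k + r\<close>,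
  so \<open>div 5\<close> and \<open>mod 5\<close> recover copy and vertex, and the order of \<nat>
  agrees with the direction of the arcs.\<close>

definition subdivided_K4_copies :: "nat \<Rightarrow> nat graph" where
  "subdivided_K4_copies n = ({..<5 * n},
     {{5 * k + r, 5 * k + s} |k r s. k < n \<and> (r, s) \<in> subdivided_K4_arcs})"

section \<open>Earlier neighbours and greedy bounds in the copies\<close>

lemma simple_graph_subdivided_K4_copies:
  assumes "n \<ge> 1"
  shows "simple_graph (subdivided_K4_copies n)"
  using assms
  by (auto simp: simple_graph_def subdivided_K4_copies_def subdivided_K4_arcs_def nsets_def lessThan_empty_iff)

lemma subdivided_K4_copies_edgeI:
  assumes "k < n" "(r, s) \<in> subdivided_K4_arcs"
  shows "{5 * k + r, 5 * k + s} \<in> edges (subdivided_K4_copies n)"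
  using assms by (auto simp: subdivided_K4_copies_def)

lemma subdivided_K4_copies_back_neighbour:
  assumes "{u, v} \<in> edges (subdivided_K4_copies n)" "u < v"
  shows "u div 5 = v div 5" "(u mod 5, v mod 5) \<in> subdivided_K4_arcs"
proof -
  obtain k r s where rs: "{u, v} = {5 * k + r, 5 * k + s}" "(r, s) \<in> subdivided_K4_arcs"
    using assms(1) by (auto simp: subdivided_K4_copies_def)
  then have "r < s" "s < 5" by (auto simp: subdivided_K4_arcs_def)
  then have "u = 5 * k + r" "v = 5 * k + s"
    using rs(1) assms(2) by (auto simp: doubleton_eq_iff)
  then show "u div 5 = v div 5" "(u mod 5, v mod 5) \<in> subdivided_K4_arcs"
    using \<open>r < s\<close> \<open>s < 5\<close> rs(2) by auto
qed

text \<open>All earlier neighbours of \<open>v\<close> lie in the copy of \<open>v\<close>, where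
  \<open>mod 5\<close> is injective. The degree condition of the greedy lemma thus becomes a finite
  check on residues.\<close>

lemma subdivided_K4_copies_card_back_neighbours:
  "card {u \<in> S. u < v \<and> {u, v} \<in> edges (subdivided_K4_copies n)}
    \<le> card {r \<in> (\<lambda>u. u mod 5) ` S. (r, v mod 5) \<in> subdivided_K4_arcs}"
proof (rule card_inj_on_le[where f = "\<lambda>u. u mod 5"])
  let ?N = "{u \<in> S. u < v \<and> {u, v} \<in> edges (subdivided_K4_copies n)}"
  show "inj_on (\<lambda>u. u mod 5) ?N"
    by (rule inj_onI) (metis (mono_tags, lifting) mem_Collect_eq mult_div_mod_eq
        subdivided_K4_copies_back_neighbour(1))
  show "(\<lambda>u. u mod 5) ` ?N \<subseteq> {r \<in> (\<lambda>u. u mod 5) ` S. (r, v mod 5) \<in> subdivided_K4_arcs}"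
    using subdivided_K4_copies_back_neighbour(2) by auto
  \<comment> \<open>As \<open>S\<close> is arbitrary, finiteness has to come from the arcs.\<close>
  have "finite (fst ` subdivided_K4_arcs)" by (simp add: subdivided_K4_arcs_def)
  then show "finite {r \<in> (\<lambda>u. u mod 5) ` S. (r, v mod 5) \<in> subdivided_K4_arcs}"
    by (rule rev_finite_subset) force
qed

lemma subdivided_K4_copies_coloring:
  assumes "fold_cover 3 (subdivided_K4_copies n) L H"
  shows "\<exists>I. dp_coloring (subdivided_K4_copies n) H I"
proof -
  let ?G = "subdivided_K4_copies n"
  have "card {u \<in> verts ?G. u < v \<and> {u, v} \<in> edges ?G} < 3" for v
  proof -
    \<comment> \<open>Arcs into 0, 1, 2 and 3 start in 0 or 1, arcs into 4 start in 2 or 3.\<close>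
    let ?A = "if v mod 5 < 4 then {0, 1} else {2, 3 :: nat}"
    have "card {r \<in> (\<lambda>u. u mod 5) ` verts ?G. (r, v mod 5) \<in> subdivided_K4_arcs} \<le> card ?A"
      by (rule card_mono) (auto simp: subdivided_K4_arcs_def)
    also have "card ?A < 3" by auto
    finally show ?thesis
      using subdivided_K4_copies_card_back_neighbours[of "verts ?G" v n] by simp
  qed
  then show ?thesis
    using greedy_independent_set[OF assms, of "verts ?G"]
    by (auto simp: dp_coloring_def subdivided_K4_copies_def)
qed

lemma subdivided_K4_copies_independent_set:
  assumes cover: "fold_cover 2 (subdivided_K4_copies n) L H"
  shows "\<exists>I. independent_set H I \<and> card I = 3 * n"
proof -
  let ?G = "subdivided_K4_copies n"
  \<comment> \<open>In each copy the vertices 0, 2, 4 induce a path, in which every vertex has at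
    most one earlier neighbour.\<close>
  define S where "S = (\<lambda>(k, r). 5 * k + r) ` ({..<n} \<times> {0, 2, 4 :: nat})"
  have mod_S: "u mod 5 \<in> {0, 2, 4}" if u: "u \<in> S" for u
  proof -
    obtain x where "u = (case x of (k, r) \<Rightarrow> 5 * k + r)" "x \<in> {..<n} \<times> {0, 2, 4 :: nat}"
      using u unfolding S_def by (rule imageE)
    then have "snd x \<in> {0, 2, 4}" "u = 5 * fst x + snd x"
      by (simp_all only: mem_Times_iff case_prod_beta)
    moreover from this have "snd x < 5" by auto
    ultimately show ?thesis by simp
  qed
  have "r < 5" if "r \<in> {0, 2, 4 :: nat}" for r using that by auto
  then have "inj_on (\<lambda>(k, r). 5 * k + r) ({..<n} \<times> {0, 2, 4 :: nat})"
    by (intro inj_on_inverseI[where g = "\<lambda>u. (u div 5, u mod 5)"]) (clarify, simp)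
  then have "card S = 3 * n"
    unfolding S_def by (subst card_image) (auto simp: card_cartesian_product)
  moreover have "finite S" "S \<subseteq> verts ?G"
    by (auto simp: S_def subdivided_K4_copies_def)
  moreover have "card {u \<in> S. u < v \<and> {u, v} \<in> edges ?G} < 2" for v
  proof -
    let ?A = "if v mod 5 < 4 then {0} else {2 :: nat}"
    let ?M = "{r \<in> (\<lambda>u. u mod 5) ` S. (r, v mod 5) \<in> subdivided_K4_arcs}"
    have "(\<lambda>u. u mod 5) ` S \<subseteq> {0, 2, 4}" using mod_S by (rule image_subsetI)
    then have "?M \<subseteq> {0, 2, 4} \<inter> {r. (r, v mod 5) \<in> subdivided_K4_arcs}"
      unfolding Collect_conj_eq Collect_mem_eq by (rule Int_mono) simp
    also have "\<dots> \<subseteq> ?A"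
    proof
      fix r assume "r \<in> {0, 2, 4} \<inter> {r. (r, v mod 5) \<in> subdivided_K4_arcs}"
      then show "r \<in> ?A" by (elim IntE insertE emptyE) (auto simp: subdivided_K4_arcs_def)
    qed
    finally have "card ?M \<le> card ?A" by (rule card_mono[rotated]) simp
    also have "card ?A < 2" by auto
    finally show ?thesis
      using subdivided_K4_copies_card_back_neighbours[of S v n] by (rule le_less_trans[rotated])
  qed
  ultimately show ?thesis
    using greedy_independent_set[OF cover \<open>finite S\<close> \<open>S \<subseteq> verts ?G\<close>] by metis
qed

section \<open>Unbalanced cycles and the upper bound\<close>

text \<open>Only one half of the subdivided edge, the arc from 2 to 4, is crossed. Passing from 2 to
  3 through 4 then changes the label once, just like a straight edge, so every triangle of the
  original graph demands three changes.\<close>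

lemma subdivided_K4_copies_double_cover_le:
  fixes n :: nat
  defines "F \<equiv> {e. (\<lambda>u. u mod 5) ` e = {2, 4}}"
  assumes n: "n \<ge> 1"
    and I: "independent_set (double_cover (subdivided_K4_copies n) F) I"
  shows "card I \<le> 3 * n"
proof -
  let ?G = "subdivided_K4_copies n"
  define A where "A = fst ` I"
  obtain c :: "nat \<Rightarrow> bool"
    where c: "\<forall>u\<in>A. \<forall>v\<in>A. {u, v} \<in> edges ?G \<longrightarrow> (c u = c v \<longleftrightarrow> {u, v} \<in> F)"
    using double_cover_switching[OF I simple_graph_subdivided_K4_copies[OF n], folded A_def] by blast
  have "A \<subseteq> {..<5 * n}"
    using I by (auto simp: A_def independent_set_def double_cover_def subdivided_K4_copies_def)
  then have A: "A = (\<Union>k<n. A \<inter> {5 * k..<5 * k + 5})"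
  proof -
    have "x \<in> (\<Union>k<n. A \<inter> {5 * k..<5 * k + 5})" if "x \<in> A" for x
    proof
      show "x div 5 \<in> {..<n}" using that \<open>A \<subseteq> {..<5 * n}\<close> by (auto simp: less_mult_imp_div_less mult.commute)
      show "x \<in> A \<inter> {5 * (x div 5)..<5 * (x div 5) + 5}" using that by simp
    qed
    then show ?thesis by blast
  qed
  have copy: "card (A \<inter> {5 * k..<5 * k + 5}) \<le> 3" if "k < n" for k
  proof -
    have in_F: "{5 * k + r, 5 * k + s} \<in> F \<longleftrightarrow> r = 2 \<and> s = 4"
      if "(r, s) \<in> subdivided_K4_arcs" for r s
    proof -
      have "r < s" "s < 5" using that by (auto simp: subdivided_K4_arcs_def)
      then show ?thesis by (auto simp: F_def doubleton_eq_iff)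
    qed
    define a where "a r \<longleftrightarrow> 5 * k + r \<in> A" for r
    define d where "d r = c (5 * k + r)" for r
    have sw: "d r = d s \<longleftrightarrow> r = 2 \<and> s = 4"
      if "(r, s) \<in> subdivided_K4_arcs" "a r" "a s" for r s
      using c that(2,3) subdivided_K4_copies_edgeI[OF \<open>k < n\<close> that(1)] in_F[OF that(1)]
      by (simp add: a_def d_def)
    have "a 0 \<and> a 1 \<longrightarrow> d 0 \<noteq> d 1" "a 0 \<and> a 2 \<longrightarrow> d 0 \<noteq> d 2" "a 0 \<and> a 3 \<longrightarrow> d 0 \<noteq> d 3"
      "a 1 \<and> a 2 \<longrightarrow> d 1 \<noteq> d 2" "a 1 \<and> a 3 \<longrightarrow> d 1 \<noteq> d 3"
      "a 2 \<and> a 4 \<longrightarrow> d 2 = d 4" "a 3 \<and> a 4 \<longrightarrow> d 3 \<noteq> d 4"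
      using sw[of 0 1] sw[of 0 2] sw[of 0 3] sw[of 1 2] sw[of 1 3] sw[of 2 4] sw[of 3 4]
      by (simp_all add: subdivided_K4_arcs_def)
    \<comment> \<open>Each of these vertex sets carries a cycle with exactly three straight edges,
      so the label would change an odd number of times.\<close>
    then have cyc: "\<not> (a 0 \<and> a 1 \<and> a 2)" "\<not> (a 0 \<and> a 1 \<and> a 3)"
        "\<not> (a 0 \<and> a 2 \<and> a 3 \<and> a 4)" "\<not> (a 1 \<and> a 2 \<and> a 3 \<and> a 4)"
      by argo+
    \<comment> \<open>No residue lies in all four sets of \<open>cyc\<close>: 0 misses the fourth, 1
      the third, 2 the second, 3 and 4 the first. Removing a single vertex therefore leaves one of
      the cycles intact.\<close>
    have "\<exists>p q. p < 5 \<and> q < 5 \<and> p \<noteq> q \<and> \<not> a p \<and> \<not> a q"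
    proof (rule ccontr)
      assume "\<not> ?thesis"
      then have mem: "a p \<or> a q" if "p < 5" "q < 5" "p \<noteq> q" for p q
        using that by blast
      have "a 0 \<or> a 1" "a 0 \<or> a 2" "a 0 \<or> a 3" "a 0 \<or> a 4" "a 1 \<or> a 2"
        "a 1 \<or> a 3" "a 1 \<or> a 4" "a 2 \<or> a 3" "a 2 \<or> a 4" "a 3 \<or> a 4"
        by (rule mem; simp)+
      then show False using cyc by argo
    qed
    then obtain p q where pq: "p < 5" "q < 5" "p \<noteq> q" "5 * k + p \<notin> A" "5 * k + q \<notin> A"
      by (auto simp: a_def)
    then have "card (A \<inter> {5 * k..<5 * k + 5}) \<le> card ({5 * k..<5 * k + 5} - {5 * k + p, 5 * k + q})"
      by (intro card_mono) auto
    also have "\<dots> = 3" using pq by (subst card_Diff_subset) auto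
    finally show ?thesis .
  qed
  have "card I = card A"
    unfolding A_def using double_cover_inj_on_fst[OF I] by (simp add: card_image)
  also have "\<dots> \<le> (\<Sum>k<n. card (A \<inter> {5 * k..<5 * k + 5}))"
    by (subst A) (rule card_UN_le, simp)
  also have "\<dots> \<le> (\<Sum>k<n. 3)" by (rule sum_mono) (use copy in simp)
  finally show ?thesis by simp
qed

section \<open>Values of the partial and the full DP-chromatic number\<close>

lemma partial_dp_chromatic_number_subdivided_K4_copies:
  assumes n: "n \<ge> 1"
  shows "partial_dp_chromatic_number 2 (subdivided_K4_copies n) = 3 * n"
  unfolding partial_dp_chromatic_number_def
proof (rule Least_equality)
  let ?G = "subdivided_K4_copies n"
  \<comment> \<open>The vertex type of \<open>H\<close> is left general: the bound is applied to the
    double cover, whose vertices are pairs, and to covers on \<nat>.\<close>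
  have lower: "3 * n \<le> independence_number H" if "fold_cover 2 ?G L H" for L and H :: "'b graph"
  proof -
    have "finite (verts H)"
      using that by (simp add: fold_cover_def dp_cover_def simple_graph_def)
    then show ?thesis
      using subdivided_K4_copies_independent_set[OF that] card_le_independence_number by metis
  qed
  let ?H = "double_cover ?G {e. (\<lambda>u. u mod 5) ` e = {2, 4}}"
  have cover: "fold_cover 2 ?G (\<lambda>v. {v} \<times> UNIV) ?H"
    using fold_cover_double_cover[OF simple_graph_subdivided_K4_copies[OF n]] .
  have "independence_number ?H \<le> 3 * n"
    by (rule independence_number_le)
      (auto simp: subdivided_K4_copies_double_cover_le[OF n],
        simp add: double_cover_def subdivided_K4_copies_def)
  then have "independence_number ?H = 3 * n" using lower[OF cover] by simp
  then show "\<exists>L (H :: nat graph). fold_cover 2 ?G L H \<and> independence_number H = 3 * n"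
    using fold_cover_relabel_nat[OF cover] by metis
  fix k assume "\<exists>L (H :: nat graph). fold_cover 2 ?G L H \<and> independence_number H = k"
  then show "3 * n \<le> k" using lower by blast
qed

text \<open>The lower bound puts 2 into the range of \<open>t\<close> tested for niceness; the upper
  bound makes the threshold at \<open>t = 2\<close> at least \<open>10 * n / 3\<close>.\<close>

lemma dp_chromatic_number_subdivided_K4_copies:
  assumes n: "n \<ge> 1"
  shows "dp_chromatic_number (subdivided_K4_copies n) \<in> {2..3}"
proof -
  let ?G = "subdivided_K4_copies n"
  let ?P = "\<lambda>m. 1 \<le> m \<and>
    (\<forall>L (H :: nat graph). fold_cover m ?G L H \<longrightarrow> (\<exists>I. dp_coloring ?G H I))"
  have P3: "?P 3" using subdivided_K4_copies_coloring by auto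
  have "\<not> ?P 1"
  proof
    assume "?P 1"
    then obtain I where "dp_coloring ?G ?G I"
      using fold_cover_trivial[OF simple_graph_subdivided_K4_copies[OF n]] by blast
    then have I: "independent_set ?G I" "card I = card (verts ?G)"
      by (simp_all add: dp_coloring_def)
    have "finite (verts ?G)" by (simp add: subdivided_K4_copies_def)
    \<comment> \<open>A colouring of the trivial cover would use every vertex, although 0 and 1 are
      adjacent.\<close>
    then have "I = verts ?G" using I by (intro card_subset_eq) (auto simp: independent_set_def)
    moreover have "{0, 1} \<in> edges ?G"
      using subdivided_K4_copies_edgeI[of 0 n 0 1] n by (simp add: subdivided_K4_arcs_def)
    moreover have "0 \<in> verts ?G" "1 \<in> verts ?G" using n by (auto simp: subdivided_K4_copies_def)
    ultimately show False using I(1) by (auto simp: independent_set_def indep_def)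
  qed
  moreover have "?P (dp_chromatic_number ?G)"
    unfolding dp_chromatic_number_def by (rule LeastI) (rule P3)
  moreover have "dp_chromatic_number ?G \<le> 3"
    unfolding dp_chromatic_number_def by (rule Least_le) (rule P3)
  ultimately have "dp_chromatic_number ?G \<noteq> 1" "1 \<le> dp_chromatic_number ?G"
    "dp_chromatic_number ?G \<le> 3" by metis+
  then show ?thesis by simp
qed

theorem corollary13:
  fixes n :: nat
  assumes "n \<ge> 1"
  shows "\<exists>G :: nat graph. simple_graph G \<and> card (verts G) = 5 * n \<and>
           \<not> partially_dp_nice G \<and>
           partial_dp_chromatic_number 2 G = 3 * n \<and>
           real (3 * n) < 2 * real (card (verts G)) / 3 \<and>
           2 * real (card (verts G)) / 3 = 10 * real n / 3"
proof -
  let ?G = "subdivided_K4_copies n"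
  have card: "card (verts ?G) = 5 * n" by (simp add: subdivided_K4_copies_def)
  have alpha: "partial_dp_chromatic_number 2 ?G = 3 * n"
    using partial_dp_chromatic_number_subdivided_K4_copies[OF assms] .
  have "dp_chromatic_number ?G \<in> {2..3}"
    using dp_chromatic_number_subdivided_K4_copies[OF assms] .
  \<comment> \<open>After clearing the denominator: the DP-chromatic number is at most 3, so the
    left side is at most \<open>9 * n\<close>, below \<open>10 * n\<close> as \<open>n\<close> is
    positive.\<close>
  then have "real (3 * n) < real 2 * real (5 * n) / real (dp_chromatic_number ?G)"
    and "2 \<in> {1..dp_chromatic_number ?G}"
    using assms by (auto simp: less_divide_eq intro: le_less_trans[of _ "3 * real n * 3"])
  then have "\<not> partially_dp_nice ?G"
    unfolding partially_dp_nice_def using alpha card by (metis not_le)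
  then show ?thesis
    using simple_graph_subdivided_K4_copies[OF assms] card alpha assms
    by (intro exI[of _ ?G]) auto
qed

end
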